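(* There exist a smooth ($\mathcal{C}^\infty$) map $u:\mathbf{D}\to\mathbb{C}^2$ and a function $\epsilon:\mathbf{D}\to[0,+\infty)$ with $\epsilon(z)\to 0$ as $z\to 0$ such that $$\left|\frac{\partial u}{\partial\overline z}(z)\right|\le \epsilon(z)\left|\frac{\partial u}{\partial z}(z)\right|\qquad\text{for } z\in\mathbf{D},$$ and such that: $u$ vanishes to infinite order at $0$; $u$ has a non-isolated zero at $0$; but $u$ is not identically $0$ near $0$ (i.e. $u$ does not vanish identically on any neighborhood of $0$).
   Context: $\mathbf{D}$ denotes the open unit disc in $\mathbb{C}$, with coordinate $z=x+iy$; $\frac{\partial}{\partial z}=\frac12\big(\frac{\partial}{\partial x}-i\frac{\partial}{\partial y}\big)$ and $\frac{\partial}{\partial\overline z}=\frac12\big(\frac{\partial}{\partial x}+i\frac{\partial}{\partial y}\big)$ act componentwise on $\mathbb{C}^2$-valued maps, and $|\cdot|$ is the Euclidean norm on $\mathbb{C}^2$. "Vanishes to infinite order at $0$" means $u(z)=O(|z|^N)$ as $z\to 0$ for every $N\in\mathbb{N}$. "Non-isolated zero at $0$" means $u(0)=0$ and every neighborhood of $0$ contains a point $z\ne 0$ with $u(z)=0$. *)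

theory Defs
  imports "HOL-Analysis.Analysis" "HOL-Library.Landau_Symbols"
begin

text \<open>Real \<open>C\<^sup>n\<close> differentiability on an open set: all iterated directional
  derivatives up to order \<open>n\<close> exist (as values of Frechet derivatives) and are continuous.\<close>

fun Ck_on :: "nat \<Rightarrow> ('a::euclidean_space \<Rightarrow> 'b::real_normed_vector) \<Rightarrow> 'a set \<Rightarrow> bool" where
  "Ck_on 0 f S \<longleftrightarrow> continuous_on S f"
| "Ck_on (Suc n) f S \<longleftrightarrow> (\<forall>x\<in>S. f differentiable (at x)) \<and>
     (\<forall>v. Ck_on n (\<lambda>x. frechet_derivative f (at x) v) S)"

definition smooth_on :: "('a::euclidean_space \<Rightarrow> 'b::real_normed_vector) \<Rightarrow> 'a set \<Rightarrow> bool" where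
  "smooth_on f S \<longleftrightarrow> (\<forall>n. Ck_on n f S)"

definition partial_x :: "(complex \<Rightarrow> 'b::real_normed_vector) \<Rightarrow> complex \<Rightarrow> 'b" where
  "partial_x f z = vector_derivative (\<lambda>t::real. f (z + of_real t)) (at 0)"

definition partial_y :: "(complex \<Rightarrow> 'b::real_normed_vector) \<Rightarrow> complex \<Rightarrow> 'b" where
  "partial_y f z = vector_derivative (\<lambda>t::real. f (z + \<i> * of_real t)) (at 0)"

definition d_dz :: "(complex \<Rightarrow> complex ^ 'n) \<Rightarrow> complex \<Rightarrow> complex ^ 'n" where
  "d_dz u z = (1 / 2) *s (partial_x u z - \<i> *s partial_y u z)"

definition d_dzbar :: "(complex \<Rightarrow> complex ^ 'n) \<Rightarrow> complex \<Rightarrow> complex ^ 'n" where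
  "d_dzbar u z = (1 / 2) *s (partial_x u z + \<i> *s partial_y u z)"

definition vanishes_to_infinite_order_at_0 :: "(complex \<Rightarrow> 'b::real_normed_vector) \<Rightarrow> bool" where
  "vanishes_to_infinite_order_at_0 u \<longleftrightarrow>
     (\<forall>N::nat. (\<lambda>z. norm (u z)) \<in> O[at 0](\<lambda>z. norm z ^ N))"

end

theory Submission imports Defs begin

text \<open>
  On \<open>|z| \<approx> 64\<^sup>-\<^sup>k\<close> only one component of \<open>u\<close>, chosen by the parity of \<open>k\<close>, matters: it equals the
  holomorphic function \<open>h\<^sub>k(z) = a\<^sub>k z\<^sup>k (64\<^sup>k z - 1)\<close>, which vanishes at \<open>64\<^sup>-\<^sup>k\<close>. Between two such
  annuli the next function is first switched on by a cutoff in the other component, and only then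
  is the previous one switched off. Hence at every point some \<open>h\<^sub>k\<close> is present with cutoff \<open>1\<close>, and
  its contribution of size \<open>k |h\<^sub>k| / |z|\<close> to \<open>\<partial>u/\<partial>z\<close> beats by a factor of order \<open>k\<close> the derivative
  of the cutoff of its neighbour, once the \<open>a\<^sub>k\<close> make neighbours comparable where they overlap.
  The zeros and critical points of \<open>h\<^sub>k\<close> lie where the other component is zero. The size of \<open>u\<close>
  on \<open>|z| \<approx> 64\<^sup>-\<^sup>k\<close> is about \<open>8\<close> to the power \<open>- k\<^sup>2\<close>, so \<open>u\<close> is flat at \<open>0\<close>.
\<close>

subsection \<open>Calculus of \<open>C\<^sup>n\<close> functions\<close>

lemma Ck_on_cong:
  assumes "open S" "\<And>x. x \<in> S \<Longrightarrow> f x = g x" "Ck_on n f S"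
  shows "Ck_on n g S"
  using assms(2,3)
proof (induction n arbitrary: f g)
  case 0
  then show ?case using continuous_on_cong[of S S f g] by simp
next
  case (Suc n)
  have D: "(g has_derivative frechet_derivative f (at x)) (at x)" if "x \<in> S" for x
    using Suc.prems that assms(1) frechet_derivative_works
    by (intro has_derivative_transform_within_open[of f _ x UNIV S g]) auto
  have eq: "frechet_derivative f (at x) v = frechet_derivative g (at x) v" if "x \<in> S" for x v
    using frechet_derivative_at[OF D[OF that]] by simp
  have f': "Ck_on n (\<lambda>x. frechet_derivative f (at x) v) S" for v
    using Suc.prems(2) by simp
  have "Ck_on n (\<lambda>x. frechet_derivative g (at x) v) S" for v
    by (rule Suc.IH[of "\<lambda>x. frechet_derivative f (at x) v", OF eq f'])
  then show ?case using D unfolding Ck_on.simps differentiable_def by blast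
qed

lemma Ck_on_SucI:
  assumes "open S" "\<And>x. x \<in> S \<Longrightarrow> (f has_derivative D x) (at x)"
    and "\<And>v. Ck_on n (\<lambda>x. D x v) S"
  shows "Ck_on (Suc n) f S"
proof -
  have eq: "D x v = frechet_derivative f (at x) v" if "x \<in> S" for x v
    using frechet_derivative_at[OF assms(2)[OF that]] by simp
  have "Ck_on n (\<lambda>x. frechet_derivative f (at x) v) S" for v
    by (rule Ck_on_cong[of S "\<lambda>x. D x v", OF assms(1) eq assms(3)])
  then show ?thesis using assms(2) unfolding Ck_on.simps differentiable_def by blast
qed

lemma Ck_on_Suc_has_derivative:
  assumes "Ck_on (Suc n) f S" "x \<in> S"
  shows "(f has_derivative frechet_derivative f (at x)) (at x)"
  using assms frechet_derivative_works by auto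

lemma Ck_on_SucD: "Ck_on (Suc n) f S \<Longrightarrow> Ck_on n f S"
proof (induction n arbitrary: f)
  case 0
  then show ?case
    by (simp add: continuous_at_imp_continuous_on differentiable_imp_continuous_within)
next
  case (Suc n)
  show ?case
    unfolding Ck_on.simps(2)[of n f]
  proof (intro conjI allI)
    show "\<forall>x\<in>S. f differentiable at x"
      using Suc.prems unfolding Ck_on.simps(2)[of "Suc n" f] by (rule conjunct1)
    show "Ck_on n (\<lambda>x. frechet_derivative f (at x) v) S" for v
      using Suc.prems unfolding Ck_on.simps(2)[of "Suc n" f] by (intro Suc.IH) (elim conjE, erule spec)
  qed
qed

lemma Ck_on_const: "Ck_on n (\<lambda>x. c) S"
  by (induction n arbitrary: c) auto

lemma Ck_on_bounded_linear:
  assumes "bounded_linear L" "open S" "Ck_on n f S"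
  shows "Ck_on n (\<lambda>x. L (f x)) S"
  using assms(3)
proof (induction n arbitrary: f)
  case 0
  then show ?case using bounded_linear.continuous_on[OF assms(1)] by simp
next
  case (Suc n)
  show ?case
  proof (rule Ck_on_SucI[OF assms(2)])
    show "((\<lambda>x. L (f x)) has_derivative (\<lambda>v. L (frechet_derivative f (at x) v))) (at x)"
      if "x \<in> S" for x
      using assms(1) Ck_on_Suc_has_derivative[OF Suc.prems that]
      by (rule bounded_linear.has_derivative)
    show "Ck_on n (\<lambda>x. L (frechet_derivative f (at x) v)) S" for v
      using Suc by simp
  qed
qed

lemma Ck_on_linear:
  assumes "bounded_linear L" "open S"
  shows "Ck_on n L S"
proof (cases n)
  case 0
  then show ?thesis
    using linear_continuous_on[OF assms(1)] by simp
next
  case (Suc m)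
  show ?thesis unfolding Suc
    by (rule Ck_on_SucI[OF assms(2) bounded_linear_imp_has_derivative[OF assms(1)] Ck_on_const])
qed

lemma Ck_on_add:
  assumes "open S" "Ck_on n f S" "Ck_on n g S"
  shows "Ck_on n (\<lambda>x. f x + g x) S"
  using assms(2,3)
proof (induction n arbitrary: f g)
  case 0
  then show ?case by (simp add: continuous_on_add)
next
  case (Suc n)
  show ?case
    by (rule Ck_on_SucI[OF assms(1) has_derivative_add[OF
          Ck_on_Suc_has_derivative[OF Suc.prems(1)] Ck_on_Suc_has_derivative[OF Suc.prems(2)]]])
      (use Suc in simp_all)
qed

lemma Ck_on_mult:
  fixes f g :: "'a::euclidean_space \<Rightarrow> 'b::real_normed_algebra"
  assumes "open S" "Ck_on n f S" "Ck_on n g S"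
  shows "Ck_on n (\<lambda>x. f x * g x) S"
  using assms(2,3)
proof (induction n arbitrary: f g)
  case 0
  then show ?case by (simp add: continuous_on_mult)
next
  case (Suc n)
  show ?case
  proof (rule Ck_on_SucI[OF assms(1) has_derivative_mult[OF
          Ck_on_Suc_has_derivative[OF Suc.prems(1)] Ck_on_Suc_has_derivative[OF Suc.prems(2)]]])
    show "Ck_on n (\<lambda>x. f x * frechet_derivative g (at x) v + frechet_derivative f (at x) v * g x) S"
      for v
      using Suc.prems by (intro Ck_on_add assms(1) Suc.IH Ck_on_SucD[OF Suc.prems(1)]
          Ck_on_SucD[OF Suc.prems(2)]) simp_all
  qed
qed

text \<open>On the real line the derivative of \<open>s\<close> acts by multiplication with its
  value at \<open>1\<close>. The chain rule thus gives a product whose second factor is again a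
  function of \<open>q\<close>, so the induction varies \<open>s\<close> and keeps \<open>q\<close>
  fixed.\<close>

lemma Ck_on_compose_real:
  fixes s :: "real \<Rightarrow> real" and q :: "'a::euclidean_space \<Rightarrow> real"
  assumes "open S" "Ck_on n s UNIV" "Ck_on n q S"
  shows "Ck_on n (\<lambda>x. s (q x)) S"
  using assms(2,3)
proof (induction n arbitrary: s)
  case 0
  then show ?case
    using continuous_on_compose2[of UNIV s S q] by simp
next
  case (Suc n)
  show ?case
  proof (rule Ck_on_SucI[OF assms(1)])
    fix x assume x: "x \<in> S"
    have lin: "frechet_derivative s (at y) v = v * frechet_derivative s (at y) 1" for y v
    proof -
      have "linear (frechet_derivative s (at y))"
        using Suc.prems(1) by (intro linear_frechet_derivative) simp
      from linear_cmul[OF this, of v 1] show ?thesis by simp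
    qed
    have "((\<lambda>x. s (q x)) has_derivative
        (\<lambda>v. frechet_derivative s (at (q x)) (frechet_derivative q (at x) v))) (at x)"
      by (rule has_derivative_compose[OF Ck_on_Suc_has_derivative[OF Suc.prems(2) x]
            Ck_on_Suc_has_derivative[OF Suc.prems(1) UNIV_I]])
    then show "((\<lambda>x. s (q x)) has_derivative
        (\<lambda>v. frechet_derivative q (at x) v * frechet_derivative s (at (q x)) 1)) (at x)"
      by (subst (asm) lin)
  next
    show "Ck_on n (\<lambda>x. frechet_derivative q (at x) v * frechet_derivative s (at (q x)) 1) S" for v
      by (intro Ck_on_mult assms(1) Suc.IH[of "\<lambda>y. frechet_derivative s (at y) 1"]
          Ck_on_SucD[OF Suc.prems(2)]) (use Suc.prems in simp_all)
  qed
qed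

text \<open>The derivative is built from \<open>inverse\<close> and a constant, so the induction
  closes on itself.\<close>

lemma Ck_on_inverse: "Ck_on n (inverse :: complex \<Rightarrow> complex) (- {0})"
proof (induction n)
  case 0
  then show ?case by (auto intro!: continuous_intros)
next
  case (Suc n)
  show ?case
  proof (rule Ck_on_SucI[OF open_Compl[OF closed_singleton]])
    show "(inverse has_derivative (\<lambda>h. - (inverse x * h * inverse x))) (at x)"
      if "x \<in> - {0}" for x :: complex
      using that by (intro has_derivative_inverse') auto
    show "Ck_on n (\<lambda>x. - (inverse x * h * inverse x)) (- {0})" for h :: complex
      using Suc by (intro Ck_on_bounded_linear[OF bounded_linear_minus[OF bounded_linear_ident]]
          Ck_on_mult Ck_on_const open_Compl closed_singleton)
  qed
qed

lemma Ck_on_subset: "Ck_on n f T \<Longrightarrow> S \<subseteq> T \<Longrightarrow> Ck_on n f S"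
proof (induction n arbitrary: f)
  case 0
  then show ?case by (auto elim: continuous_on_subset)
qed auto

lemma Ck_on_Un:
  assumes "open S" "open T" "Ck_on n f S" "Ck_on n f T"
  shows "Ck_on n f (S \<union> T)"
  using assms(3,4)
  by (induction n arbitrary: f) (use assms(1,2) in \<open>auto simp: continuous_on_open_Un\<close>)

subsection \<open>A smooth step function\<close>

text \<open>The powers of \<open>1 / t\<close> make the span of this family closed under
  differentiation.\<close>

definition flat_exp :: "nat \<Rightarrow> real \<Rightarrow> real" where
  "flat_exp n t = (if t > 0 then exp (- inverse t) * inverse t ^ n else 0)"

lemma flat_exp_tendsto_0: "(flat_exp n \<longlongrightarrow> 0) (at 0)"
proof -
  have "((\<lambda>y::real. y ^ n / exp y) \<longlongrightarrow> 0) at_top" by (rule tendsto_power_div_exp_0)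
  then have "((\<lambda>t::real. inverse t ^ n / exp (inverse t)) \<longlongrightarrow> 0) (at_right 0)"
    using filterlim_compose filterlim_inverse_at_top_right by blast
  moreover have "\<forall>\<^sub>F t in at_right 0. inverse t ^ n / exp (inverse t) = flat_exp n t"
    by (auto simp: flat_exp_def eventually_at_filter exp_minus field_simps)
  ultimately have R: "(flat_exp n \<longlongrightarrow> 0) (at_right 0)"
    using tendsto_cong by force
  have "\<forall>\<^sub>F t in at_left 0. 0 = flat_exp n t"
    by (auto simp: flat_exp_def eventually_at_filter)
  then have "(flat_exp n \<longlongrightarrow> 0) (at_left 0)"
    by (rule Lim_transform_eventually[OF tendsto_const])
  with R show ?thesis by (simp add: filterlim_split_at)
qed

lemma flat_exp_has_derivative:
  "(flat_exp n has_real_derivative flat_exp (n + 2) t - n * flat_exp (n + 1) t) (at t)"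
proof (cases t "0::real" rule: linorder_cases)
  case less
  have "((\<lambda>t. 0) has_real_derivative 0) (at t)" by auto
  then have "(flat_exp n has_real_derivative 0) (at t)"
    by (rule has_field_derivative_transform_within_open[of _ _ _ "{..<0}"])
      (use less in \<open>auto simp: flat_exp_def\<close>)
  then show ?thesis using less by (simp add: flat_exp_def)
next
  case equal
  \<comment> \<open>Dividing by \<open>h\<close> raises the index, so the difference quotient at
    \<open>0\<close> is itself a member of the family.\<close>
  have "((\<lambda>h. flat_exp (Suc n) h) \<longlongrightarrow> 0) (at 0)" by (rule flat_exp_tendsto_0)
  moreover have "\<forall>\<^sub>F h in at 0. flat_exp (Suc n) h = (flat_exp n (0 + h) - flat_exp n 0) / h"
    by (auto simp: flat_exp_def eventually_at_filter divide_inverse)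
  ultimately have "((\<lambda>h. (flat_exp n (0 + h) - flat_exp n 0) / h) \<longlongrightarrow> 0) (at 0)"
    using tendsto_cong by force
  then show ?thesis using equal by (simp add: DERIV_def flat_exp_def)
next
  case greater
  have "((\<lambda>t. exp (- inverse t) * inverse t ^ n) has_real_derivative
      exp (- inverse t) * inverse t ^ (n + 2) - n * (exp (- inverse t) * inverse t ^ (n + 1))) (at t)"
    using greater
    by (auto intro!: derivative_eq_intros simp: field_simps power2_eq_square)
      (cases n; simp add: field_simps)
  then have "(flat_exp n has_real_derivative
      exp (- inverse t) * inverse t ^ (n + 2) - n * (exp (- inverse t) * inverse t ^ (n + 1))) (at t)"
    by (rule has_field_derivative_transform_within_open[of _ _ _ "{0<..}"])
      (use greater in \<open>auto simp: flat_exp_def\<close>)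
  then show ?thesis using greater by (simp add: flat_exp_def)
qed

lemma Ck_on_flat_exp: "Ck_on k (flat_exp n) UNIV"
proof (induction k arbitrary: n)
  case 0
  then show ?case
    using DERIV_isCont[OF flat_exp_has_derivative]
    by (auto intro: continuous_at_imp_continuous_on)
next
  case (Suc k)
  show ?case
  proof (rule Ck_on_SucI)
    show "(flat_exp n has_derivative
        (\<lambda>v. (flat_exp (n + 2) t + (- n) * flat_exp (n + 1) t) * v)) (at t)" for t
      using flat_exp_has_derivative[of n t] by (simp add: has_field_derivative_def)
    show "Ck_on k (\<lambda>t. (flat_exp (n + 2) t + (- n) * flat_exp (n + 1) t) * v) UNIV" for v
      using Suc by (intro Ck_on_mult Ck_on_add Ck_on_const) auto
  qed auto
qed

text \<open>Nesting replaces the usual quotient of bump functions: the factor \<open>exp 1\<close>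
  makes the inner value at least \<open>1\<close> for \<open>t \<le> 0\<close> and the outer value
  exactly \<open>1\<close> for \<open>t \<ge> 1\<close>.\<close>

definition smooth_step :: "real \<Rightarrow> real" where
  "smooth_step t = exp 1 * flat_exp 0 (1 - exp 1 * flat_exp 0 (1 - t))"

lemma Ck_on_smooth_step: "Ck_on n smooth_step UNIV"
proof -
  have "Ck_on n (\<lambda>t. exp 1 * flat_exp 0 (1 + (- exp 1) * flat_exp 0 (1 + (- 1) * t))) UNIV"
    by (intro Ck_on_mult Ck_on_const Ck_on_compose_real[OF _ Ck_on_flat_exp] Ck_on_add
        Ck_on_linear bounded_linear_mult_right) auto
  then show ?thesis by (simp add: smooth_step_def[abs_def])
qed

lemma smooth_step_eq_0: "t \<le> 0 \<Longrightarrow> smooth_step t = 0"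
proof -
  assume t: "t \<le> 0"
  have "inverse (1 - t) \<le> 1" using t by (simp add: inverse_le_1_iff)
  then have "1 \<le> exp (1 - inverse (1 - t))" by simp
  also have "\<dots> = exp 1 * flat_exp 0 (1 - t)"
    using t by (simp add: flat_exp_def flip: exp_add)
  finally show ?thesis by (simp add: smooth_step_def flat_exp_def)
qed

lemma smooth_step_eq_1: "t \<ge> 1 \<Longrightarrow> smooth_step t = 1"
  by (simp add: smooth_step_def flat_exp_def exp_minus)

subsection \<open>Series supported on geometric annuli\<close>

text \<open>
  The radii leave room for two neighbours to overlap, but never for two terms of equal parity.
\<close>

definition annular :: "(complex \<Rightarrow> complex) \<Rightarrow> bool" where
  "annular \<phi> \<longleftrightarrow> (\<forall>n. Ck_on n \<phi> UNIV) \<and>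
     (\<forall>w. \<phi> w \<noteq> 0 \<longrightarrow> 1 / 32 \<le> norm w \<and> norm w \<le> 8)"

lemma annularD_Ck: "annular \<phi> \<Longrightarrow> Ck_on n \<phi> UNIV"
  by (simp add: annular_def)

lemma annularD_support: "annular \<phi> \<Longrightarrow> norm w < 1 / 32 \<or> 8 < norm w \<Longrightarrow> \<phi> w = 0"
  by (auto simp: annular_def not_le)

lemma annular_has_derivative:
  "annular \<phi> \<Longrightarrow> (\<phi> has_derivative frechet_derivative \<phi> (at w)) (at w)"
  using Ck_on_Suc_has_derivative[of 0 \<phi> UNIV w] annularD_Ck by blast

lemma annular_directional_derivative:
  assumes "annular \<phi>"
  shows "annular (\<lambda>w. frechet_derivative \<phi> (at w) v)"
  unfolding annular_def
proof (intro conjI allI impI)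
  show "Ck_on n (\<lambda>w. frechet_derivative \<phi> (at w) v) UNIV" for n
    using annularD_Ck[OF assms, of "Suc n"] by simp
next
  fix w assume nz: "frechet_derivative \<phi> (at w) v \<noteq> 0"
  let ?U = "ball 0 (1 / 32) \<union> - cball 0 8 :: complex set"
  have "w \<notin> ?U"
  proof
    assume w: "w \<in> ?U"
    have "((\<lambda>w. 0) has_derivative (\<lambda>h. 0)) (at w)" by simp
    then have "(\<phi> has_derivative (\<lambda>h. 0)) (at w)"
      by (rule has_derivative_transform_within_open[of _ _ _ _ ?U])
        (use w in \<open>auto simp: annularD_support[OF assms] intro!: open_Un open_Compl\<close>)
    then show False using nz frechet_derivative_at by metis
  qed
  then show "1 / 32 \<le> norm w" "norm w \<le> 8" by auto
qed

lemma annular_add: "annular \<phi> \<Longrightarrow> annular \<psi> \<Longrightarrow> annular (\<lambda>w. \<phi> w + \<psi> w)"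
  by (force simp: annular_def intro: Ck_on_add[OF open_UNIV])

lemma annular_cmult: "annular \<phi> \<Longrightarrow> annular (\<lambda>w. c * \<phi> w)"
  unfolding annular_def by (auto intro: Ck_on_mult[OF open_UNIV Ck_on_const])

text \<open>Division by \<open>w\<close> is harmless because \<open>\<phi>\<close> is zero near
  \<open>0\<close>. Such quotients arise when \<open>z ^ k\<close> is differentiated.\<close>

lemma annular_inverse_mult:
  assumes "annular \<phi>"
  shows "annular (\<lambda>w. inverse w * \<phi> w)"
  unfolding annular_def
proof (intro conjI allI impI)
  fix n
  have "Ck_on n (\<lambda>w. inverse w * \<phi> w) (- {0})"
    by (intro Ck_on_mult Ck_on_inverse open_Compl closed_singleton
        Ck_on_subset[OF annularD_Ck[OF assms]]) simp
  moreover have "Ck_on n (\<lambda>w. inverse w * \<phi> w) (ball 0 (1 / 32))"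
    by (rule Ck_on_cong[OF open_ball _ Ck_on_const[of n 0]]) (simp add: annularD_support[OF assms])
  ultimately have "Ck_on n (\<lambda>w. inverse w * \<phi> w) (- {0} \<union> ball 0 (1 / 32))"
    by (intro Ck_on_Un open_Compl closed_singleton open_ball)
  moreover have "- {0} \<union> ball 0 (1 / 32) = (UNIV :: complex set)" by auto
  ultimately show "Ck_on n (\<lambda>w. inverse w * \<phi> w) UNIV" by simp
qed (use assms in \<open>auto simp: annular_def\<close>)

lemma annular_bounded:
  assumes "annular \<phi>"
  obtains B where "B > 0" "\<And>w. norm (\<phi> w) \<le> B"
proof -
  have "continuous_on (cball 0 8) \<phi>"
    using annularD_Ck[OF assms, of 0] continuous_on_subset by auto
  then have "bounded (\<phi> ` cball 0 8)"
    by (intro compact_imp_bounded compact_continuous_image compact_cball)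
  then obtain B where B: "B > 0" "\<And>w. w \<in> cball 0 8 \<Longrightarrow> norm (\<phi> w) \<le> B"
    by (auto simp: bounded_pos)
  have "norm (\<phi> w) \<le> B" for w
    using B annularD_support[OF assms, of w] by (cases "norm w \<le> 8") auto
  with B(1) show ?thesis using that by blast
qed

text \<open>On the support of the \<open>k\<close>-th term \<open>norm z ^ k\<close> is
  \<open>1 / 64 ^ (k * k)\<close> up to factors geometric in \<open>k\<close>. The condition makes
  \<open>d k * z ^ k\<close> decay there faster than any geometric sequence, which absorbs the
  factors that differentiation produces.\<close>

definition rapid :: "(nat \<Rightarrow> complex) \<Rightarrow> bool" where
  "rapid d \<longleftrightarrow> (\<forall>M>0. \<exists>C. \<forall>k. norm (d k) * M ^ k \<le> C * 64 ^ (k * k))"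

lemma rapid_dominated:
  assumes "rapid d" "A > 0" "\<And>k. norm (e k) \<le> norm (d k) * A ^ k"
  shows "rapid e"
  unfolding rapid_def
proof (intro allI impI)
  fix M :: real assume M: "M > 0"
  then obtain C where C: "\<And>k. norm (d k) * (A * M) ^ k \<le> C * 64 ^ (k * k)"
    using assms(1,2) unfolding rapid_def by (meson mult_pos_pos)
  have "norm (e k) * M ^ k \<le> C * 64 ^ (k * k)" for k
  proof -
    have "norm (e k) * M ^ k \<le> norm (d k) * A ^ k * M ^ k"
      using assms(3) M by (intro mult_right_mono) auto
    also have "\<dots> \<le> C * 64 ^ (k * k)" using C[of k] by (simp add: power_mult_distrib mult.assoc)
    finally show ?thesis .
  qed
  then show "\<exists>C. \<forall>k. norm (e k) * M ^ k \<le> C * 64 ^ (k * k)" by blast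
qed

lemma rapid_scale: "rapid d \<Longrightarrow> rapid (\<lambda>k. d k * 64 ^ k)"
  by (erule rapid_dominated[of _ 64]) (auto simp: norm_mult norm_power)

lemma rapid_scale_nat:
  assumes "rapid d"
  shows "rapid (\<lambda>k. d k * of_nat k * 64 ^ k)"
proof (rule rapid_dominated[OF assms, of 128])
  fix k
  have "real k \<le> 2 ^ k" using of_nat_less_two_power[of k, where 'a=real] by linarith
  then have "real k * 64 ^ k \<le> 2 ^ k * 64 ^ k" by (intro mult_right_mono) auto
  also have "\<dots> = 128 ^ k" by (simp flip: power_mult_distrib)
  finally show "norm (d k * of_nat k * 64 ^ k) \<le> norm (d k) * 128 ^ k"
    by (simp add: norm_mult norm_power mult.assoc mult_left_mono)
qed simp

definition annular_series :: "(complex \<Rightarrow> complex) \<Rightarrow> (nat \<Rightarrow> complex) \<Rightarrow> complex \<Rightarrow> complex" where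
  "annular_series \<phi> d z = (\<Sum>k. d k * \<phi> (64 ^ k * z) * z ^ k)"

lemma annular_series_eq_sum:
  assumes "annular \<phi>" "8 < 64 ^ n * norm z"
  shows "annular_series \<phi> d z = (\<Sum>k<n. d k * \<phi> (64 ^ k * z) * z ^ k)"
  unfolding annular_series_def
proof (rule suminf_finite)
  fix k assume "k \<notin> {..<n}"
  then have "64 ^ n * norm z \<le> 64 ^ k * norm z"
    by (intro mult_right_mono power_increasing) auto
  then have "8 < norm (64 ^ k * z)" using assms(2) by (simp add: norm_mult norm_power)
  then show "d k * \<phi> (64 ^ k * z) * z ^ k = 0" by (simp add: annularD_support[OF assms(1)])
qed simp

lemma annular_series_eq_single:
  assumes "\<And>i. i \<noteq> k \<Longrightarrow> d i = 0 \<or> \<phi> (64 ^ i * z) = 0"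
  shows "annular_series \<phi> d z = d k * \<phi> (64 ^ k * z) * z ^ k"
  unfolding annular_series_def using assms by (subst suminf_finite[of "{k}"]) auto

lemma annular_series_0: "annular \<phi> \<Longrightarrow> annular_series \<phi> d 0 = 0"
  by (subst annular_series_eq_single[of 0]) (auto simp: annularD_support)

text \<open>On the support of the \<open>k\<close>-th term \<open>32 * 64 ^ k * norm z\<close> is at
  least \<open>1\<close>, so \<open>norm z ^ N\<close> can be split off at geometric cost, which
  \<open>rapid\<close> pays.\<close>

lemma annular_series_flat:
  assumes "annular \<phi>" "rapid d"
  obtains C where "\<And>z. norm (annular_series \<phi> d z) \<le> C * norm z ^ N"
proof -
  obtain B where B: "B > 0" "\<And>w. norm (\<phi> w) \<le> B"
    using annular_bounded[OF assms(1)] by blast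
  \<comment> \<open>The base is \<open>2 * 8 * 64 ^ N\<close>: \<open>8 ^ k\<close> bounds
    \<open>(64 ^ k * norm z) ^ k\<close> on the support, \<open>64 ^ N\<close> pays for
    \<open>norm z ^ N\<close>, and \<open>2\<close> leaves the ratio \<open>1 / 2\<close> for
    summation.\<close>
  have "(16 * 64 ^ N :: real) > 0" by simp
  with assms(2) obtain C where C: "\<And>k. norm (d k) * (16 * 64 ^ N) ^ k \<le> C * 64 ^ (k * k)"
    unfolding rapid_def by meson
  have C0: "C \<ge> 0" using C[of 0] norm_ge_zero[of "d 0"] by (simp del: norm_ge_zero)
  have term_le: "norm (d k * \<phi> (64 ^ k * z) * z ^ k) \<le> B * C * 32 ^ N * norm z ^ N * (1 / 2) ^ k" for k z
  proof (cases "\<phi> (64 ^ k * z) = 0")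
    case True
    then show ?thesis using B(1) C0 by simp
  next
    case False
    define r where "r = norm z"
    have r: "1 / 32 \<le> 64 ^ k * r" "64 ^ k * r \<le> 8" "r \<ge> 0"
      using assms(1) False by (auto simp: annular_def norm_mult norm_power r_def)
    have "(16 :: real) ^ k = 2 ^ k * 8 ^ k" by (simp flip: power_mult_distrib)
    then have "norm (d k) * (64 ^ N) ^ k * 2 ^ k * r ^ k * 8 ^ k = norm (d k) * (16 * 64 ^ N) ^ k * r ^ k"
      by (simp add: power_mult_distrib mult_ac)
    also have "\<dots> \<le> C * 64 ^ (k * k) * r ^ k"
      using C[of k] r by (intro mult_right_mono) auto
    also have "\<dots> = C * (64 ^ k * r) ^ k" by (simp add: power_mult_distrib power_mult)
    also have "\<dots> \<le> C * 8 ^ k" using C0 r by (intro mult_left_mono power_mono) auto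
    finally have 1: "norm (d k) * (64 ^ N) ^ k * 2 ^ k * r ^ k \<le> C" by simp
    have "1 \<le> (32 * (64 ^ k * r)) ^ N" using r by (intro one_le_power) auto
    also have "\<dots> = 32 ^ N * (64 ^ N) ^ k * r ^ N"
      by (simp add: power_mult_distrib mult.commute flip: power_mult)
    finally have 2: "1 \<le> 32 ^ N * (64 ^ N) ^ k * r ^ N" .
    have "norm (d k) * 2 ^ k * r ^ k * 1 \<le> norm (d k) * 2 ^ k * r ^ k * (32 ^ N * (64 ^ N) ^ k * r ^ N)"
      using 2 r by (intro mult_left_mono) auto
    also have "\<dots> = (norm (d k) * (64 ^ N) ^ k * 2 ^ k * r ^ k) * (32 ^ N * r ^ N)"
      by (simp add: mult_ac)
    also have "\<dots> \<le> C * (32 ^ N * r ^ N)" using 1 r by (intro mult_right_mono) auto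
    finally have le: "norm (d k) * r ^ k \<le> C * (32 ^ N * r ^ N) * (1 / 2) ^ k"
      by (simp add: power_divide field_simps)
    have "norm (\<phi> (64 ^ k * z)) * (norm (d k) * r ^ k) \<le> B * (C * (32 ^ N * r ^ N) * (1 / 2) ^ k)"
      by (rule mult_mono[OF B(2) le]) (use B(1) r in auto)
    then show ?thesis by (simp add: norm_mult norm_power r_def mult_ac)
  qed
  have "norm (annular_series \<phi> d z) \<le> (\<Sum>k. B * C * 32 ^ N * norm z ^ N * (1 / 2) ^ k)" for z
    unfolding annular_series_def
    by (rule norm_suminf_le[OF term_le]) (intro summable_mult summable_geometric, simp)
  moreover have "(\<Sum>k. B * C * 32 ^ N * norm z ^ N * (1 / 2) ^ k) = B * C * 32 ^ N * 2 * norm z ^ N"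
    for z :: complex
    by (subst suminf_mult) (auto simp: suminf_geometric intro: summable_geometric)
  ultimately have "norm (annular_series \<phi> d z) \<le> B * C * 32 ^ N * 2 * norm z ^ N" for z by simp
  then show ?thesis by (rule that)
qed

text \<open>
  Differentiation stays within the class of series, so flatness of every series at \<open>0\<close> already
  yields smoothness there.
\<close>

lemma annular_series_has_derivative:
  assumes "annular \<phi>" "rapid d"
  shows "(annular_series \<phi> d has_derivative (\<lambda>v.
      annular_series (\<lambda>w. frechet_derivative \<phi> (at w) v) (\<lambda>k. d k * 64 ^ k) z +
      v * annular_series (\<lambda>w. inverse w * \<phi> w) (\<lambda>k. d k * of_nat k * 64 ^ k) z)) (at z)"
proof (cases "z = 0")
  case True
  \<comment> \<open>Quadratic flatness forces the derivative \<open>0\<close> at the origin, where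
    both series in the claimed derivative vanish as well.\<close>
  obtain C where C: "\<And>z. norm (annular_series \<phi> d z) \<le> C * norm z ^ 2"
    using annular_series_flat[OF assms, of 2] by blast
  have "((\<lambda>h. norm (annular_series \<phi> d (0 + h) - annular_series \<phi> d 0 - 0) / norm h) \<longlongrightarrow> 0) (at 0)"
  proof (rule tendsto_sandwich[OF _ _ tendsto_const])
    show "\<forall>\<^sub>F h in at 0. norm (annular_series \<phi> d (0 + h) - annular_series \<phi> d 0 - 0) / norm h \<le> C * norm h"
      using C by (auto simp: eventually_at_filter annular_series_0[OF assms(1)] power2_eq_square
          divide_le_eq mult.assoc intro!: always_eventually)
    show "((\<lambda>h::complex. C * norm h) \<longlongrightarrow> 0) (at 0)"
      by (auto intro!: tendsto_eq_intros)
  qed auto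
  then have "(annular_series \<phi> d has_derivative (\<lambda>h. 0)) (at 0)"
    by (simp add: has_derivative_at)
  then show ?thesis
    using assms annular_directional_derivative annular_inverse_mult
    by (simp add: True annular_series_0)
next
  case False
  \<comment> \<open>Here \<open>norm y\<close> stays away from \<open>0\<close>, so one
    \<open>n\<close> truncates the series at all points of the neighbourhood.\<close>
  let ?S = "{y :: complex. norm z / 2 < norm y}"
  obtain n where "16 / norm z < 64 ^ n" using real_arch_pow[of 64 "16 / norm z"] by auto
  then have n: "8 < 64 ^ n * (norm z / 2)" using False by (simp add: field_simps)
  have n': "8 < 64 ^ n * norm y" if "y \<in> ?S" for y
    by (rule less_le_trans[OF n]) (use that in auto)
  have zS: "z \<in> ?S" using False by simp
  \<comment> \<open>Expressing the derivative of \<open>z ^ k\<close> through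
    \<open>\<phi> w / w\<close> at \<open>w = 64 ^ k * z\<close> restores the exponent
    \<open>k\<close>, hence the shape of an annular series.\<close>
  have shift: "of_nat k * z ^ (k - 1) * \<phi> (64 ^ k * z) =
      of_nat k * 64 ^ k * (inverse (64 ^ k * z) * \<phi> (64 ^ k * z)) * z ^ k" for k
    using False by (cases k) (auto simp: field_simps)
  have "((\<lambda>z. d k * \<phi> (64 ^ k * z) * z ^ k) has_derivative
      (\<lambda>v. d k * 64 ^ k * frechet_derivative \<phi> (at (64 ^ k * z)) v * z ^ k +
        v * (d k * of_nat k * 64 ^ k * (inverse (64 ^ k * z) * \<phi> (64 ^ k * z)) * z ^ k))) (at z)" for k
  proof -
    have "linear (frechet_derivative \<phi> (at (64 ^ k * z)))"
      using annular_has_derivative[OF assms(1)] has_derivative_linear by blast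
    from linear_cmul[OF this, of "64 ^ k"]
    have lin: "frechet_derivative \<phi> (at (64 ^ k * z)) (64 ^ k * v) =
        64 ^ k * frechet_derivative \<phi> (at (64 ^ k * z)) v" for v
      by (simp add: scaleR_conv_of_real)
    have "((\<lambda>z. \<phi> (64 ^ k * z)) has_derivative
        (\<lambda>v. frechet_derivative \<phi> (at (64 ^ k * z)) (64 ^ k * v))) (at z)"
      by (rule has_derivative_compose[OF _ annular_has_derivative[OF assms(1)]])
        (auto intro!: derivative_eq_intros)
    then have "((\<lambda>z. \<phi> (64 ^ k * z)) has_derivative
        (\<lambda>v. 64 ^ k * frechet_derivative \<phi> (at (64 ^ k * z)) v)) (at z)"
      unfolding lin .
    then have "((\<lambda>z. d k * \<phi> (64 ^ k * z) * z ^ k) has_derivative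
      (\<lambda>v. d k * (64 ^ k * frechet_derivative \<phi> (at (64 ^ k * z)) v) * z ^ k +
        d k * v * (of_nat k * z ^ (k - 1) * \<phi> (64 ^ k * z)))) (at z)"
      by (auto intro!: derivative_eq_intros simp: algebra_simps fun_eq_iff)
    then show ?thesis unfolding shift by (simp add: mult_ac)
  qed
  then have "((\<lambda>z. \<Sum>k<n. d k * \<phi> (64 ^ k * z) * z ^ k) has_derivative
      (\<lambda>v. \<Sum>k<n. d k * 64 ^ k * frechet_derivative \<phi> (at (64 ^ k * z)) v * z ^ k +
        v * (d k * of_nat k * 64 ^ k * (inverse (64 ^ k * z) * \<phi> (64 ^ k * z)) * z ^ k))) (at z)"
    by (intro has_derivative_sum)
  also have "(\<lambda>v. \<Sum>k<n. d k * 64 ^ k * frechet_derivative \<phi> (at (64 ^ k * z)) v * z ^ k +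
        v * (d k * of_nat k * 64 ^ k * (inverse (64 ^ k * z) * \<phi> (64 ^ k * z)) * z ^ k)) =
    (\<lambda>v. annular_series (\<lambda>w. frechet_derivative \<phi> (at w) v) (\<lambda>k. d k * 64 ^ k) z +
      v * annular_series (\<lambda>w. inverse w * \<phi> w) (\<lambda>k. d k * of_nat k * 64 ^ k) z)"
    using n'[OF zS]
    by (simp add: annular_series_eq_sum[of _ n] assms(1) annular_directional_derivative
        annular_inverse_mult sum.distrib sum_distrib_left)
  finally show ?thesis
  proof (rule has_derivative_transform_within_open[OF _ _ zS])
    show "open ?S" by (intro open_Collect_less continuous_intros)
    show "(\<Sum>k<n. d k * \<phi> (64 ^ k * y) * y ^ k) = annular_series \<phi> d y" if "y \<in> ?S" for y
      using annular_series_eq_sum[OF assms(1) n'[OF that]] by simp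
  qed
qed

lemma Ck_on_annular_series:
  assumes "annular \<phi>" "rapid d"
  shows "Ck_on n (annular_series \<phi> d) UNIV"
  using assms
proof (induction n arbitrary: \<phi> d)
  case 0
  then show ?case
    using has_derivative_continuous[OF annular_series_has_derivative[OF 0]]
    by (simp add: continuous_at_imp_continuous_on)
next
  case (Suc n)
  show ?case
    by (rule Ck_on_SucI[OF open_UNIV annular_series_has_derivative[OF Suc.prems]])
      (intro Ck_on_add Ck_on_mult Ck_on_const open_UNIV Suc.IH annular_directional_derivative
        annular_inverse_mult rapid_scale rapid_scale_nat Suc.prems)
qed

subsection \<open>The two components\<close>

text \<open>
  The cutoff is \<open>1\<close> where \<open>3 / 1024 < |w|\<^sup>2 < 17\<close>, in particular on \<open>1 / 16 \<le> |w| \<le> 4\<close>; the dilates by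
  powers of \<open>64\<close> of the latter annulus cover the punctured plane.
\<close>

definition profile :: "complex \<Rightarrow> complex" where
  "profile w = of_real (smooth_step ((1024 * (norm w)\<^sup>2 - 1) / 2) *
     smooth_step ((64 - (norm w)\<^sup>2) / 47)) * (w - 1)"

lemma annular_profile: "annular profile"
  unfolding annular_def
proof (intro conjI allI impI)
  fix n
  \<comment> \<open>The cutoffs are rewritten in terms of a polynomial in \<open>Re w\<close> and
    \<open>Im w\<close>, to which the \<open>Ck_on\<close> rules apply.\<close>
  have affine: "(1024 * r - 1) / 2 = - 1 / 2 + 512 * r" "(64 - r) / 47 = 64 / 47 + (- 1 / 47) * r"
    for r :: real
    by (simp_all add: field_simps)
  have step: "Ck_on n (\<lambda>w. smooth_step (a + b * (Re w * Re w + Im w * Im w))) UNIV" for a b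
    by (intro Ck_on_compose_real[OF _ Ck_on_smooth_step] Ck_on_add Ck_on_mult Ck_on_const
        Ck_on_linear bounded_linear_Re bounded_linear_Im open_UNIV)
  have "Ck_on n (\<lambda>w. of_real (smooth_step (- 1 / 2 + 512 * (Re w * Re w + Im w * Im w)) *
      smooth_step (64 / 47 + (- 1 / 47) * (Re w * Re w + Im w * Im w))) * (w + (- 1))) (UNIV :: complex set)"
    by (intro Ck_on_mult Ck_on_bounded_linear[OF bounded_linear_of_real] Ck_on_add step Ck_on_const
        Ck_on_linear bounded_linear_ident open_UNIV)
  moreover have "profile = (\<lambda>w. of_real (smooth_step (- 1 / 2 + 512 * (Re w * Re w + Im w * Im w)) *
      smooth_step (64 / 47 + (- 1 / 47) * (Re w * Re w + Im w * Im w))) * (w + (- 1)))"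
    unfolding profile_def cmod_power2 unfolding affine unfolding power2_eq_square by simp
  ultimately show "Ck_on n profile UNIV" by simp
next
  fix w assume nz: "profile w \<noteq> 0"
  then have "(1 / 32)\<^sup>2 \<le> (norm w)\<^sup>2" "(norm w)\<^sup>2 \<le> 8\<^sup>2"
    using smooth_step_eq_0[of "(1024 * (norm w)\<^sup>2 - 1) / 2"] smooth_step_eq_0[of "(64 - (norm w)\<^sup>2) / 47"]
    by (force simp: profile_def power2_eq_square)+
  then show "1 / 32 \<le> norm w" "norm w \<le> 8"
    by (auto intro: power2_le_imp_le)
qed

lemma profile_core: "3 / 1024 < (norm w)\<^sup>2 \<Longrightarrow> (norm w)\<^sup>2 < 17 \<Longrightarrow> profile w = w - 1"
  by (simp add: profile_def smooth_step_eq_1)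

text \<open>The formula \<open>w - 1\<close> holds on an open set containing the closed annulus from
  \<open>1 / 16\<close> to \<open>4\<close>, so its derivative is available up to the
  boundary.\<close>

lemma profile_core_derivative:
  assumes "3 / 1024 < (norm w)\<^sup>2" "(norm w)\<^sup>2 < 17"
  shows "frechet_derivative profile (at w) v = v"
proof -
  let ?S = "{w :: complex. 3 / 1024 < (norm w)\<^sup>2} \<inter> {w. (norm w)\<^sup>2 < 17}"
  have "open ?S" by (intro open_Int open_Collect_less continuous_intros)
  have "((\<lambda>w. w - 1) has_derivative (\<lambda>v. v)) (at w)"
    by (auto intro!: derivative_eq_intros)
  then have "(profile has_derivative (\<lambda>v. v)) (at w)"
    by (rule has_derivative_transform_within_open[OF _ \<open>open ?S\<close>])
      (use assms in \<open>auto simp: profile_core\<close>)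
  then show ?thesis using frechet_derivative_at by metis
qed

text \<open>
  The recursion \<open>amp_Suc\<close> is what makes \<open>amp k * |z|\<^sup>k\<close> and \<open>amp (k + 1) * |z|\<^sup>k\<^sup>+\<^sup>1\<close> agree at
  \<open>|z| = 64\<^sup>-\<^sup>k\<close>.
\<close>

definition amp :: "nat \<Rightarrow> real" where
  "amp k = 8 ^ (k * (k - 1))"

lemma amp_pos: "amp k > 0" by (simp add: amp_def)

lemma amp_Suc: "amp (Suc k) = 64 ^ k * amp k"
proof -
  have "Suc k * (Suc k - 1) = 2 * k + k * (k - 1)" by (cases k) auto
  moreover have "(8 :: real) ^ (2 * k) = 64 ^ k" by (simp add: power_mult)
  ultimately show ?thesis unfolding amp_def by (simp only: power_add)
qed

text \<open>Zero coefficients at the wrong parity let both components be series over all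
  \<open>k\<close> with the same \<open>profile\<close>.\<close>

definition parity_amp :: "bool \<Rightarrow> nat \<Rightarrow> complex" where
  "parity_amp p k = (if even k = p then of_real (amp k) else 0)"

text \<open>\<open>amp k\<close> is at most \<open>8 ^ (k * k)\<close>, the square root of the
  allowed growth; by \<open>m * k \<le> m * m + k * k\<close> the other half absorbs
  \<open>M ^ k\<close>.\<close>

lemma rapid_parity_amp: "rapid (parity_amp p)"
  unfolding rapid_def
proof (intro allI impI)
  fix M :: real assume M: "M > 0"
  obtain m where m: "M < 8 ^ m" using real_arch_pow[of 8 M] by auto
  have "norm (parity_amp p k) * M ^ k \<le> 8 ^ (m * m) * 64 ^ (k * k)" for k
  proof -
    have "m * k \<le> m * m + k * k"
      by (cases "m \<le> k") (auto intro: mult_le_mono trans_le_add1 trans_le_add2)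
    moreover have "k * (k - 1) \<le> k * k" by simp
    ultimately have e: "k * (k - 1) + m * k \<le> m * m + 2 * (k * k)" by linarith
    have "norm (parity_amp p k) * M ^ k \<le> amp k * (8 ^ m) ^ k"
      using m M amp_pos[of k] by (intro mult_mono power_mono) (auto simp: parity_amp_def)
    also have "\<dots> = 8 ^ (k * (k - 1) + m * k)" by (simp add: amp_def power_add power_mult)
    also have "\<dots> \<le> 8 ^ (m * m + 2 * (k * k))" using e by (intro power_increasing) auto
    also have "\<dots> = 8 ^ (m * m) * 64 ^ (k * k)" by (simp add: power_add power_mult)
    finally show ?thesis .
  qed
  then show "\<exists>C. \<forall>k. norm (parity_amp p k) * M ^ k \<le> C * 64 ^ (k * k)" by blast
qed

section \<open>Derivatives of the components on the bands
  \<open>1 / 16 \<le> 64 ^ k * norm z \<le> 4\<close>\<close>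

definition component :: "bool \<Rightarrow> complex \<Rightarrow> complex" where
  "component p = annular_series profile (parity_amp p)"

definition component_deriv :: "bool \<Rightarrow> complex \<Rightarrow> complex \<Rightarrow> complex" where
  "component_deriv p z v =
     annular_series (\<lambda>w. frechet_derivative profile (at w) v) (\<lambda>k. parity_amp p k * 64 ^ k) z +
     v * annular_series (\<lambda>w. inverse w * profile w) (\<lambda>k. parity_amp p k * of_nat k * 64 ^ k) z"

lemma component_has_derivative: "(component p has_derivative component_deriv p z) (at z)"
  unfolding component_def component_deriv_def
  by (rule annular_series_has_derivative[OF annular_profile rapid_parity_amp])

text \<open>Let \<open>x = 64 ^ k * norm z\<close>; the support runs from \<open>1 / 32\<close> to
  \<open>8\<close>. Index \<open>k + 1\<close> sees \<open>64 * x\<close>, outside once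
  \<open>x > 1 / 8\<close>; index \<open>k - 1\<close> sees \<open>x / 64\<close>, outside once
  \<open>x < 2\<close>. Any other index scales by at least \<open>4096\<close>, too much for every
  \<open>x\<close> in the band.\<close>

lemma annular_off_band:
  assumes "annular \<psi>" "1 / 16 \<le> 64 ^ k * norm z" "64 ^ k * norm z \<le> 4" "i \<noteq> k"
    and "i = Suc k \<Longrightarrow> 1 / 8 < 64 ^ k * norm z" "k = Suc i \<Longrightarrow> 64 ^ k * norm z < 2"
  shows "\<psi> (64 ^ i * z) = 0"
proof (rule annularD_support[OF assms(1)])
  have n: "norm (64 ^ i * z) = 64 ^ i * norm z" by (simp add: norm_mult norm_power)
  consider "i = Suc k" | "k = Suc i" | j where "i = k + 2 + j" | j where "k = i + 2 + j"
    using assms(4) by (metis add_2_eq_Suc' add_Suc_right le_Suc_ex linorder_neqE_nat Suc_leI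
        add.assoc add_Suc add_0_right not0_implies_Suc)
  then show "norm (64 ^ i * z) < 1 / 32 \<or> 8 < norm (64 ^ i * z)"
  proof cases
    case 1
    then have "norm (64 ^ i * z) = 64 * (64 ^ k * norm z)" unfolding n by simp
    then show ?thesis using assms(5)[OF 1] by linarith
  next
    case 2
    then have "64 ^ k * norm z = 64 * norm (64 ^ i * z)" unfolding n by simp
    then show ?thesis using assms(6)[OF 2] by linarith
  next
    case 3
    have "1 * (64 ^ k * norm z) \<le> 64 ^ j * (64 ^ k * norm z)"
      by (intro mult_right_mono) auto
    moreover have "norm (64 ^ i * z) = 4096 * (64 ^ j * (64 ^ k * norm z))"
      unfolding n by (simp add: 3 power_add)
    ultimately show ?thesis using assms(2) by linarith
  next
    case 4
    have "1 * (64 ^ i * norm z) \<le> 64 ^ j * (64 ^ i * norm z)"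
      by (intro mult_right_mono) auto
    moreover have "64 ^ k * norm z = 4096 * (64 ^ j * (64 ^ i * norm z))"
      unfolding 4 by (simp add: power_add)
    ultimately show ?thesis using assms(3) n by linarith
  qed
qed

text \<open>All annular \<open>\<psi>\<close> are covered at once, since both directional
  derivatives of \<open>profile\<close> and the quotient \<open>profile w / w\<close> must be
  localised. The coefficient at \<open>k\<close> may itself be zero.\<close>

definition only_term :: "bool \<Rightarrow> nat \<Rightarrow> complex \<Rightarrow> bool" where
  "only_term p k z \<longleftrightarrow>
     (\<forall>\<psi> i. annular \<psi> \<longrightarrow> i \<noteq> k \<longrightarrow> parity_amp p i = 0 \<or> \<psi> (64 ^ i * z) = 0)"

lemma component_deriv_single:
  assumes "only_term p k z"
  shows "component_deriv p z v = parity_amp p k * 64 ^ k * z ^ k *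
    (frechet_derivative profile (at (64 ^ k * z)) v + v * (of_nat k * (inverse (64 ^ k * z) * profile (64 ^ k * z))))"
proof -
  have 1: "annular_series (\<lambda>w. frechet_derivative profile (at w) v) (\<lambda>k. parity_amp p k * 64 ^ k) z =
      parity_amp p k * 64 ^ k * frechet_derivative profile (at (64 ^ k * z)) v * z ^ k"
    using assms annular_directional_derivative[OF annular_profile, of v]
    by (intro annular_series_eq_single) (auto simp: only_term_def)
  have 2: "annular_series (\<lambda>w. inverse w * profile w) (\<lambda>k. parity_amp p k * of_nat k * 64 ^ k) z =
      parity_amp p k * of_nat k * 64 ^ k * (inverse (64 ^ k * z) * profile (64 ^ k * z)) * z ^ k"
  proof (rule annular_series_eq_single)
    show "parity_amp p i * of_nat i * 64 ^ i = 0 \<or> inverse (64 ^ i * z) * profile (64 ^ i * z) = 0"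
      if "i \<noteq> k" for i
      using assms annular_inverse_mult[OF annular_profile] that by (fastforce simp: only_term_def)
  qed
  show ?thesis unfolding component_deriv_def 1 2 by (simp add: algebra_simps)
qed

text \<open>The neighbours of \<open>k\<close> have the other parity and all further terms vanish on
  the band. What is left is complex linear in \<open>v\<close>, so this component contributes
  nothing to the antiholomorphic derivative.\<close>

lemma component_deriv_own:
  assumes "1 / 16 \<le> 64 ^ k * norm z" "64 ^ k * norm z \<le> 4"
  shows "component_deriv (even k) z v =
    v * (of_real (amp k) * 64 ^ k * z ^ k * ((of_nat (Suc k) * (64 ^ k * z) - of_nat k) / (64 ^ k * z)))"
proof -
  have w: "norm (64 ^ k * z) = 64 ^ k * norm z" by (simp add: norm_mult norm_power)
  have "(1 / 16)\<^sup>2 \<le> (64 ^ k * norm z)\<^sup>2" "(64 ^ k * norm z)\<^sup>2 \<le> 4\<^sup>2"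
    using assms by (intro power_mono; simp)+
  then have core: "3 / 1024 < (norm (64 ^ k * z))\<^sup>2" "(norm (64 ^ k * z))\<^sup>2 < 17"
    unfolding w by (simp_all add: power2_eq_square)
  have z: "z \<noteq> 0" using assms by auto
  have "parity_amp (even k) i = 0 \<or> \<psi> (64 ^ i * z) = 0" if "annular \<psi>" "i \<noteq> k" for \<psi> i
    using annular_off_band[OF that(1) assms that(2)] by (cases "i = Suc k \<or> k = Suc i") (auto simp: parity_amp_def)
  then have "only_term (even k) k z" by (simp add: only_term_def)
  note * = component_deriv_single[OF this, of v]
  show ?thesis
    unfolding * profile_core[OF core] profile_core_derivative[OF core]
    using z by (simp add: parity_amp_def field_simps)
qed

text \<open>The contribution of \<open>z ^ k\<close> is complex linear in \<open>v\<close> and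
  cancels, as \<open>1 + \<i> * \<i> = 0\<close>. Only the derivative of \<open>profile\<close>
  remains, so no factor \<open>k\<close> appears.\<close>

lemma component_deriv_bound:
  obtains B where "B > 0" "\<And>p k z. only_term p k z \<Longrightarrow>
    norm (component_deriv p z 1 + \<i> * component_deriv p z \<i>) \<le> B * (amp k * 64 ^ k * norm z ^ k)"
proof -
  let ?\<psi> = "\<lambda>w. frechet_derivative profile (at w) 1 + \<i> * frechet_derivative profile (at w) \<i>"
  have "annular ?\<psi>"
    by (intro annular_add annular_cmult annular_directional_derivative annular_profile)
  then obtain B where B: "B > 0" "\<And>w. norm (?\<psi> w) \<le> B" using annular_bounded by blast
  have "norm (component_deriv p z 1 + \<i> * component_deriv p z \<i>) \<le> B * (amp k * 64 ^ k * norm z ^ k)"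
    if *: "only_term p k z" for p k z
  proof -
    let ?w = "64 ^ k * z"
    have "component_deriv p z 1 + \<i> * component_deriv p z \<i> = parity_amp p k * 64 ^ k * z ^ k * ?\<psi> ?w"
      unfolding component_deriv_single[OF *] by (simp add: algebra_simps)
    then have "norm (component_deriv p z 1 + \<i> * component_deriv p z \<i>) =
        norm (parity_amp p k) * 64 ^ k * norm z ^ k * norm (?\<psi> ?w)"
      by (simp add: norm_mult norm_power)
    also have "\<dots> \<le> amp k * 64 ^ k * norm z ^ k * B"
      using B amp_pos[of k] by (intro mult_mono) (auto simp: parity_amp_def)
    finally show ?thesis by (simp add: mult_ac)
  qed
  with B(1) show ?thesis using that by blast
qed

text \<open>Where the other component is active, the derivative of the holomorphic one carries a
  factor of order \<open>k\<close> that the other side lacks; \<open>Suc k\<close> records this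
  gain. The factors \<open>1 / 2\<close> of the Wirtinger derivatives are left out on both
  sides.\<close>

lemma wirtinger_ratio:
  obtains C where "C > 0" "\<And>k z. 1 / 16 \<le> 64 ^ k * norm z \<Longrightarrow> 64 ^ k * norm z \<le> 4 \<Longrightarrow>
    norm (component_deriv (odd k) z 1 + \<i> * component_deriv (odd k) z \<i>) * real (Suc k) \<le>
    C * norm (component_deriv (even k) z 1 - \<i> * component_deriv (even k) z \<i>)"
proof -
  obtain B where B: "B > 0"
    "\<And>p k z. only_term p k z \<Longrightarrow>
      norm (component_deriv p z 1 + \<i> * component_deriv p z \<i>) \<le> B * (amp k * 64 ^ k * norm z ^ k)"
    using component_deriv_bound by blast
  have "norm (component_deriv (odd k) z 1 + \<i> * component_deriv (odd k) z \<i>) * real (Suc k) \<le>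
      8 * B * norm (component_deriv (even k) z 1 - \<i> * component_deriv (even k) z \<i>)"
    if band: "1 / 16 \<le> 64 ^ k * norm z" "64 ^ k * norm z \<le> 4" for k z
  proof -
    define x where "x = 64 ^ k * norm z"
    define A where "A = amp k * 64 ^ k * norm z ^ k"
    define q where "q = norm (of_nat (Suc k) * (64 ^ k * z) - of_nat k)"
    let ?other = "norm (component_deriv (odd k) z 1 + \<i> * component_deriv (odd k) z \<i>)"
    have x: "1 / 16 \<le> x" "x \<le> 4" using band by (auto simp: x_def)
    have z: "z \<noteq> 0" using band by auto
    have A: "A > 0" using amp_pos z by (simp add: A_def)
    have nw: "norm (of_nat (Suc k) * (64 ^ k * z)) = real (Suc k) * x"
      by (simp add: norm_mult norm_power x_def del: of_nat_Suc)
    have q: "q \<ge> \<bar>real (Suc k) * x - real k\<bar>"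
      using norm_triangle_ineq3[of "of_nat (Suc k) * (64 ^ k * z)" "of_nat k"] unfolding nw q_def by simp
    let ?G = "of_real (amp k) * 64 ^ k * z ^ k * ((of_nat (Suc k) * (64 ^ k * z) - of_nat k) / (64 ^ k * z))"
    have "component_deriv (even k) z 1 - \<i> * component_deriv (even k) z \<i> = 2 * ?G"
      unfolding component_deriv_own[OF band] by (simp flip: mult.assoc)
    then have own: "norm (component_deriv (even k) z 1 - \<i> * component_deriv (even k) z \<i>) = 2 * A * q / x"
      using amp_pos[of k] unfolding A_def x_def q_def
      by (simp add: norm_mult norm_divide norm_power del: of_nat_Suc)
    have odd_k: "parity_amp (odd k) k = 0" by (simp add: parity_amp_def)
    \<comment> \<open>The thresholds are those of \<open>annular_off_band\<close>: only
      \<open>k + 1\<close> can interfere in the first case, only \<open>k - 1\<close> in the last.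
      In between, where the bound on \<open>q\<close> may degenerate, the other component has
      derivative \<open>0\<close>.\<close>
    consider "x \<le> 1 / 8" | "1 / 8 < x" "k = 0 \<or> x < 2" | j where "2 \<le> x" "k = Suc j"
      by (metis linorder_not_le not0_implies_Suc)
    then show ?thesis
    proof cases
      case 1
      have lt: "64 ^ k * norm z < 2" using 1 unfolding x_def by linarith
      have "?other \<le> B * (amp (Suc k) * 64 ^ Suc k * norm z ^ Suc k)"
      proof (rule B(2), unfold only_term_def, intro allI impI)
        show "parity_amp (odd k) i = 0 \<or> \<psi> (64 ^ i * z) = 0" if "annular \<psi>" "i \<noteq> Suc k" for \<psi> i
          using odd_k annular_off_band[OF that(1) band, of i] that(2) lt by blast
      qed
      \<comment> \<open>The neighbour is \<open>64 * x \<le> 8\<close> times as large as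
        \<open>A\<close>, whence the \<open>8\<close> in the constant.\<close>
      also have "amp (Suc k) * 64 ^ Suc k * norm z ^ Suc k = A * (64 * x)"
        by (simp add: amp_Suc A_def x_def)
      also have "B * (A * (64 * x)) \<le> B * (A * 8)"
        using 1 A B(1) by (intro mult_left_mono) auto
      finally have other: "?other \<le> 8 * B * A" by (simp add: mult_ac)
      have "real (Suc k) / 16 \<le> q"
      proof (cases "k = 0")
        case True
        then show ?thesis using q x by simp
      next
        case False
        define y where "y = real (Suc k) * x"
        have "y \<le> real (Suc k) * (1 / 8)" using 1 unfolding y_def by (intro mult_left_mono) auto
        moreover have "real k - y \<le> q" using q unfolding y_def by linarith
        ultimately show ?thesis using False by simp
      qed
      moreover have "x * real (Suc k) \<le> 1 / 8 * real (Suc k)" using 1 by (intro mult_right_mono) auto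
      ultimately have "x * real (Suc k) \<le> 2 * q" by linarith
      then have "real (Suc k) \<le> 2 * q / x" using x by (simp add: le_divide_eq mult.commute)
      then have "?other * real (Suc k) \<le> (8 * B * A) * (2 * q / x)"
        using other A B(1) by (intro mult_mono) auto
      then show ?thesis unfolding own by (simp add: mult_ac)
    next
      case 2
      have gt: "1 / 8 < 64 ^ k * norm z" and lt: "k = 0 \<or> 64 ^ k * norm z < 2"
        using 2 unfolding x_def by auto
      have "parity_amp (odd k) i = 0 \<or> \<psi> (64 ^ i * z) = 0" if "annular \<psi>" for \<psi> i
        using odd_k annular_off_band[OF that band, of i] gt lt by blast
      then have "component_deriv (odd k) z v = 0" for v
        using component_deriv_single[of "odd k" k z v] odd_k by (auto simp: only_term_def)
      then show ?thesis using B(1) by simp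
    next
      case 3
      have gt: "1 / 8 < 64 ^ k * norm z" using 3(1) unfolding x_def by linarith
      have "?other \<le> B * (amp j * 64 ^ j * norm z ^ j)"
      proof (rule B(2), unfold only_term_def, intro allI impI)
        show "parity_amp (odd k) i = 0 \<or> \<psi> (64 ^ i * z) = 0" if "annular \<psi>" "i \<noteq> j" for \<psi> i
          using odd_k annular_off_band[OF that(1) band, of i] that(2) gt 3(2) by blast
      qed
      also have "amp j * 64 ^ j * norm z ^ j = A / x"
        using z by (simp add: amp_Suc A_def x_def 3(2))
      finally have other: "?other \<le> B * A / x" by simp
      have "real (Suc k) * 2 \<le> real (Suc k) * x" using 3 by (intro mult_left_mono) auto
      \<comment> \<open>In fact \<open>q\<close> is at least \<open>k + 2\<close>; the factor
        \<open>16\<close> is chosen to reach the same constant \<open>8 * B\<close> as in the first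
        case.\<close>
      then have "real (Suc k) \<le> 16 * q" using q by simp
      then have "?other * real (Suc k) \<le> B * A / x * (16 * q)"
        using other A B(1) x by (intro mult_mono) auto
      then show ?thesis unfolding own by (simp add: mult_ac)
    qed
  qed
  then show ?thesis using B(1) that[of "8 * B"] by simp
qed

text \<open>The ends of a band have ratio \<open>64\<close>, so consecutive bands abut and the least
  admissible \<open>k\<close> works; \<open>norm z < 1\<close> settles \<open>k = 0\<close>.\<close>

lemma ex_band:
  assumes "z \<noteq> 0" "norm z < 1"
  obtains k where "1 / 16 \<le> 64 ^ k * norm z" "64 ^ k * norm z \<le> 4"
proof -
  let ?P = "\<lambda>k. 1 / 16 \<le> 64 ^ k * norm z"
  obtain n where "1 / (16 * norm z) < 64 ^ n" using real_arch_pow[of 64 "1 / (16 * norm z)"] by auto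
  then have "?P n" using assms(1) by (simp add: field_simps)
  then have P: "?P (LEAST k. ?P k)" by (rule LeastI)
  have "64 ^ (LEAST k. ?P k) * norm z \<le> 4"
  proof (cases "LEAST k. ?P k")
    case 0
    then show ?thesis using assms(2) by simp
  next
    case (Suc j)
    then have "64 ^ j * norm z < 1 / 16" using not_less_Least[of j ?P] by simp
    then show ?thesis unfolding Suc power_Suc mult.assoc by linarith
  qed
  with P show ?thesis using that by blast
qed

section \<open>The pair as a vector-valued map and its Wirtinger derivatives\<close>

lemma bounded_linear_axis: "bounded_linear (axis i :: 'b::real_normed_vector \<Rightarrow> 'b ^ 'n)"
proof (rule bounded_linear_intro[of _ 1])
  show "norm (axis i x :: 'b ^ 'n) \<le> norm x * 1" for x :: 'b
    by (simp add: norm_vec_def axis_def if_distrib[of norm] L2_set_def if_distrib[of "\<lambda>x. x ^ 2"] cong: if_cong)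
qed (auto simp: axis_def vec_eq_iff)

definition pair_map :: "complex \<Rightarrow> complex ^ 2" where
  "pair_map z = axis 1 (component True z) + axis 2 (component False z)"

lemma pair_map_nth: "pair_map z $ 1 = component True z" "pair_map z $ 2 = component False z"
  by (auto simp: pair_map_def axis_def)

lemma norm_vec2_le: "norm (x :: complex ^ 2) \<le> norm (x $ 1) + norm (x $ 2)"
  using L2_set_le_sum[of UNIV "\<lambda>i. norm (x $ i)"] by (simp add: norm_vec_def UNIV_2)

lemma pair_map_has_derivative:
  "(pair_map has_derivative
    (\<lambda>v. axis 1 (component_deriv True z v) + axis 2 (component_deriv False z v))) (at z)"
  unfolding pair_map_def[abs_def]
  by (intro has_derivative_add bounded_linear.has_derivative[OF bounded_linear_axis]
      component_has_derivative)

lemma partial_x_eq: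
  assumes "(f has_derivative F) (at z)"
  shows "partial_x f z = F 1"
proof -
  have "((\<lambda>t::real. z + of_real t) has_derivative (\<lambda>t. of_real t)) (at 0)"
    by (auto intro!: derivative_eq_intros)
  from has_derivative_compose[OF this, of f F] assms
  have "((\<lambda>t::real. f (z + of_real t)) has_derivative (\<lambda>t. F (of_real t))) (at 0)" by simp
  moreover have "F (of_real t) = t *\<^sub>R F 1" for t
    using linear_cmul[OF has_derivative_linear[OF assms], of t 1] by (simp add: scaleR_conv_of_real)
  ultimately show ?thesis
    unfolding partial_x_def by (intro vector_derivative_at) (simp add: has_vector_derivative_def)
qed

lemma partial_y_eq:
  assumes "(f has_derivative F) (at z)"
  shows "partial_y f z = F \<i>"
proof -
  have "((\<lambda>t::real. z + \<i> * of_real t) has_derivative (\<lambda>t. \<i> * of_real t)) (at 0)"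
    by (auto intro!: derivative_eq_intros)
  from has_derivative_compose[OF this, of f F] assms
  have "((\<lambda>t::real. f (z + \<i> * of_real t)) has_derivative (\<lambda>t. F (\<i> * of_real t))) (at 0)" by simp
  moreover have "F (\<i> * of_real t) = t *\<^sub>R F \<i>" for t
    using linear_cmul[OF has_derivative_linear[OF assms], of t \<i>]
    by (simp add: scaleR_conv_of_real mult.commute)
  ultimately show ?thesis
    unfolding partial_y_def by (intro vector_derivative_at) (simp add: has_vector_derivative_def)
qed

lemma d_dz_pair_map:
  "d_dz pair_map z $ 1 = (component_deriv True z 1 - \<i> * component_deriv True z \<i>) / 2"
  "d_dz pair_map z $ 2 = (component_deriv False z 1 - \<i> * component_deriv False z \<i>) / 2"
  by (auto simp: d_dz_def partial_x_eq[OF pair_map_has_derivative]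
      partial_y_eq[OF pair_map_has_derivative] axis_def)

lemma d_dzbar_pair_map:
  "d_dzbar pair_map z $ 1 = (component_deriv True z 1 + \<i> * component_deriv True z \<i>) / 2"
  "d_dzbar pair_map z $ 2 = (component_deriv False z 1 + \<i> * component_deriv False z \<i>) / 2"
  by (auto simp: d_dzbar_def partial_x_eq[OF pair_map_has_derivative]
      partial_y_eq[OF pair_map_has_derivative] axis_def)

text \<open>In band \<open>k\<close> the component with the parity of \<open>k\<close> drops out of
  \<open>d_dzbar\<close> and bounds \<open>d_dz\<close> from below.\<close>

lemma pair_map_ratio:
  obtains C where "C > 0" "\<And>k z. 1 / 16 \<le> 64 ^ k * norm z \<Longrightarrow> 64 ^ k * norm z \<le> 4 \<Longrightarrow>
    norm (d_dzbar pair_map z) * real (Suc k) \<le> C * norm (d_dz pair_map z)"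
proof -
  obtain C where C: "C > 0" "\<And>k z. 1 / 16 \<le> 64 ^ k * norm z \<Longrightarrow> 64 ^ k * norm z \<le> 4 \<Longrightarrow>
    norm (component_deriv (odd k) z 1 + \<i> * component_deriv (odd k) z \<i>) * real (Suc k) \<le>
    C * norm (component_deriv (even k) z 1 - \<i> * component_deriv (even k) z \<i>)"
    using wirtinger_ratio by blast
  have "norm (d_dzbar pair_map z) * real (Suc k) \<le> C * norm (d_dz pair_map z)"
    if band: "1 / 16 \<le> 64 ^ k * norm z" "64 ^ k * norm z \<le> 4" for k z
  proof -
    let ?o = "norm (component_deriv (odd k) z 1 + \<i> * component_deriv (odd k) z \<i>)"
    let ?e = "norm (component_deriv (even k) z 1 - \<i> * component_deriv (even k) z \<i>)"
    have 0: "component_deriv (even k) z 1 + \<i> * component_deriv (even k) z \<i> = 0"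
      unfolding component_deriv_own[OF band] by (simp flip: mult.assoc)
    have "norm (d_dzbar pair_map z) \<le> ?o / 2"
      using norm_vec2_le[of "d_dzbar pair_map z"] 0
      by (cases "even k") (simp_all add: d_dzbar_pair_map norm_divide)
    then have "norm (d_dzbar pair_map z) * real (Suc k) \<le> ?o / 2 * real (Suc k)"
      by (intro mult_right_mono) auto
    also have "\<dots> \<le> C * (?e / 2)" using C(2)[OF band] by simp
    also have "?e / 2 \<le> norm (d_dz pair_map z)"
      using Finite_Cartesian_Product.norm_nth_le[of "d_dz pair_map z" 1] Finite_Cartesian_Product.norm_nth_le[of "d_dz pair_map z" 2]
      by (cases "even k") (simp_all add: d_dz_pair_map norm_divide)
    finally show ?thesis using C(1) by (simp add: mult_left_mono)
  qed
  with C(1) show ?thesis using that by blast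
qed

section \<open>Smoothness, flatness and zeros of the map\<close>

lemma smooth_on_pair_map: "smooth_on pair_map S"
proof -
  have "Ck_on n pair_map UNIV" for n
    unfolding pair_map_def[abs_def] component_def
    by (intro Ck_on_add Ck_on_bounded_linear[OF bounded_linear_axis] open_UNIV
        Ck_on_annular_series annular_profile rapid_parity_amp)
  then show ?thesis using Ck_on_subset unfolding smooth_on_def by blast
qed

lemma pair_map_flat: "vanishes_to_infinite_order_at_0 pair_map"
  unfolding vanishes_to_infinite_order_at_0_def
proof
  fix N
  obtain C1 where C1: "\<And>z. norm (component True z) \<le> C1 * norm z ^ N"
    unfolding component_def using annular_series_flat[OF annular_profile rapid_parity_amp, of True N] by blast
  obtain C2 where C2: "\<And>z. norm (component False z) \<le> C2 * norm z ^ N"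
    unfolding component_def using annular_series_flat[OF annular_profile rapid_parity_amp, of False N] by blast
  have "norm (pair_map z) \<le> (C1 + C2) * norm z ^ N" for z
    using norm_vec2_le[of "pair_map z"] C1[of z] C2[of z] by (simp add: pair_map_nth distrib_right)
  then show "(\<lambda>z. norm (pair_map z)) \<in> O[at 0](\<lambda>z. norm z ^ N)"
    by (intro bigoI[of _ "C1 + C2"] always_eventually) simp
qed

text \<open>Here \<open>64 ^ k * z = 1\<close> is the zero of \<open>profile\<close>, and since
  \<open>1\<close> lies between \<open>1 / 8\<close> and \<open>2\<close> every other term vanishes
  too.\<close>

lemma pair_map_eq_0: "pair_map (inverse (64 ^ k)) = 0"
proof -
  let ?z = "inverse (64 ^ k) :: complex"
  have nz: "64 ^ k * norm ?z = 1" by (simp add: norm_inverse norm_power)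
  have off: "profile (64 ^ i * ?z) = 0" if "i \<noteq> k" for i
    by (rule annular_off_band[OF annular_profile _ _ that]) (unfold nz, simp_all)
  have "profile 1 = 0" by (simp add: profile_def)
  then have "component p ?z = 0" for p
    unfolding component_def by (subst annular_series_eq_single[of k]) (auto dest: off)
  then show ?thesis by (simp add: vec_eq_iff forall_2 pair_map_nth)
qed

text \<open>The value \<open>1 / 2\<close> of \<open>64 ^ k * z\<close> also lies between
  \<open>1 / 8\<close> and \<open>2\<close>, but \<open>profile\<close> does not vanish there, so
  exactly one term survives.\<close>

lemma pair_map_neq_0: "pair_map (inverse (2 * 64 ^ k)) \<noteq> 0"
proof -
  let ?z = "inverse (2 * 64 ^ k) :: complex"
  have nz: "64 ^ k * norm ?z = 1 / 2" by (simp add: norm_inverse norm_power norm_mult)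
  have off: "profile (64 ^ i * ?z) = 0" if "i \<noteq> k" for i
    by (rule annular_off_band[OF annular_profile _ _ that]) (unfold nz, simp_all)
  have "profile (1 / 2) = - 1 / 2" by (subst profile_core) (auto simp: norm_divide power2_eq_square)
  moreover have "component (even k) ?z = parity_amp (even k) k * profile (64 ^ k * ?z) * ?z ^ k"
    unfolding component_def by (rule annular_series_eq_single[OF disjI2]) (rule off)
  ultimately have "component (even k) ?z \<noteq> 0"
    using amp_pos[of k] by (simp add: parity_amp_def)
  then show ?thesis using pair_map_nth[of ?z] by (cases "even k") auto
qed

lemma inverse_power_tendsto_0: "(\<lambda>k. inverse (64 ^ k) :: complex) \<longlonglongrightarrow> 0"
proof -
  have "(\<lambda>k. inverse 64 ^ k :: complex) \<longlonglongrightarrow> 0" by (rule LIMSEQ_power_zero) (simp add: norm_inverse)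
  then show ?thesis by (simp only: power_inverse)
qed

theorem proposition2:
  "\<exists>(u :: complex \<Rightarrow> complex ^ 2) (\<epsilon> :: complex \<Rightarrow> real).
     smooth_on u (ball 0 1) \<and>
     (\<forall>z\<in>ball 0 1. 0 \<le> \<epsilon> z) \<and>
     (\<epsilon> \<longlongrightarrow> 0) (at 0) \<and>
     (\<forall>z\<in>ball 0 1. norm (d_dzbar u z) \<le> \<epsilon> z * norm (d_dz u z)) \<and>
     vanishes_to_infinite_order_at_0 u \<and>
     u 0 = 0 \<and> 0 islimpt {z \<in> ball 0 1. u z = 0} \<and>
     \<not> (\<forall>\<^sub>F z in nhds 0. u z = 0)"
proof -
  obtain C where C: "C > 0" "\<And>k z. 1 / 16 \<le> 64 ^ k * norm z \<Longrightarrow> 64 ^ k * norm z \<le> 4 \<Longrightarrow>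
    norm (d_dzbar pair_map z) * real (Suc k) \<le> C * norm (d_dz pair_map z)"
    using pair_map_ratio by blast
  \<comment> \<open>The quotient is \<open>0\<close> by convention where the denominator is zero;
    the inequality survives because the numerator is then zero as well.\<close>
  define \<epsilon> where "\<epsilon> z = norm (d_dzbar pair_map z) / norm (d_dz pair_map z)" for z
  have \<epsilon>_nonneg: "0 \<le> \<epsilon> z" for z by (simp add: \<epsilon>_def)
  have pair_0: "pair_map 0 = 0"
    by (simp add: vec_eq_iff forall_2 pair_map_nth component_def annular_series_0 annular_profile)
  have deriv_0: "component_deriv p 0 v = 0" for p v
    by (simp add: component_deriv_def annular_series_0 annular_directional_derivative
        annular_inverse_mult annular_profile)

  have ineq: "norm (d_dzbar pair_map z) \<le> \<epsilon> z * norm (d_dz pair_map z)" if "z \<in> ball 0 1" for z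
  proof (cases "z = 0")
    case True
    have "d_dzbar pair_map 0 = 0"
      by (simp add: vec_eq_iff forall_2 d_dzbar_pair_map deriv_0)
    then show ?thesis by (simp add: True \<epsilon>_nonneg)
  next
    case False
    with that obtain k where "1 / 16 \<le> 64 ^ k * norm z" "64 ^ k * norm z \<le> 4"
      using ex_band[of z] by auto
    from C(2)[OF this] have "d_dz pair_map z = 0 \<Longrightarrow> d_dzbar pair_map z = 0"
      by (auto simp: mult_le_0_iff)
    then show ?thesis by (auto simp: \<epsilon>_def)
  qed

  have lim: "(\<epsilon> \<longlongrightarrow> 0) (at 0)"
  proof (rule tendstoI)
    fix e :: real assume e: "e > 0"
    obtain n where n: "C / e < real n" using reals_Archimedean2 by blast
    \<comment> \<open>So small a \<open>z\<close> lies only in bands of index above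
      \<open>n\<close>, where the quotient is at most \<open>C / Suc k\<close>, hence below
      \<open>e\<close>.\<close>
    have "\<epsilon> z < e" if z: "z \<noteq> 0" "norm z < inverse (16 * 64 ^ n)" for z
    proof -
      have "inverse (16 * 64 ^ n) \<le> (1 :: real)"
        by (intro inverse_le_1_iff[THEN iffD2] disjI2) (metis mult_mono' one_le_numeral one_le_power zero_le_one mult_1)
      with z obtain k where k: "1 / 16 \<le> 64 ^ k * norm z" "64 ^ k * norm z \<le> 4"
        using ex_band[of z] by auto
      have "64 ^ k * norm z < 64 ^ k * inverse (16 * 64 ^ n)" using z by (intro mult_strict_left_mono) auto
      with k(1) have "(1 :: real) / 16 < 64 ^ k * inverse (16 * 64 ^ n)" by linarith
      then have "(64 :: real) ^ n < 64 ^ k" by (simp add: field_simps)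
      then have "n < k" by simp
      then have "C / e < real (Suc k)" using n by simp
      then have "C < e * real (Suc k)" using e by (simp add: field_simps)
      moreover have "\<epsilon> z * real (Suc k) \<le> C"
        using C(2)[OF k] C(1) by (cases "norm (d_dz pair_map z) = 0") (auto simp: \<epsilon>_def divide_simps mult_ac)
      ultimately have "\<epsilon> z * real (Suc k) < e * real (Suc k)" by linarith
      then show ?thesis by (simp del: of_nat_Suc)
    qed
    then show "\<forall>\<^sub>F z in at 0. dist (\<epsilon> z) 0 < e"
      unfolding eventually_at by (intro exI[of _ "inverse (16 * 64 ^ n)"]) (auto simp: \<epsilon>_nonneg)
  qed

  have zeros: "0 islimpt {z \<in> ball 0 1. pair_map z = 0}"
    unfolding islimpt_sequential
  proof (intro exI conjI allI)
    \<comment> \<open>Index \<open>0\<close> would give the point \<open>1\<close>, outside the open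
      disc.\<close>
    show "inverse (64 ^ Suc k) \<in> {z \<in> ball 0 1. pair_map z = 0} - {0}" for k
    proof -
      have "1 < (64 :: real) ^ Suc k" by (rule one_less_power) auto
      then show ?thesis
        using pair_map_eq_0[of "Suc k"] by (simp add: norm_inverse norm_power inverse_less_1_iff del: power_Suc)
    qed
    show "(\<lambda>k. inverse (64 ^ Suc k) :: complex) \<longlonglongrightarrow> 0"
      by (rule LIMSEQ_Suc[OF inverse_power_tendsto_0])
  qed

  have "\<not> (\<forall>\<^sub>F z in nhds 0. pair_map z = 0)"
  proof
    assume ev: "\<forall>\<^sub>F z in nhds 0. pair_map z = 0"
    have "(\<lambda>k. inverse 2 * inverse (64 ^ k) :: complex) \<longlonglongrightarrow> 0"
      using tendsto_mult_right_zero[OF inverse_power_tendsto_0] .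
    then have "\<forall>\<^sub>F k in sequentially. pair_map (inverse 2 * inverse (64 ^ k)) = 0"
      using ev unfolding filterlim_iff by blast
    then show False using pair_map_neq_0 by (auto simp: eventually_sequentially)
  qed
  with smooth_on_pair_map \<epsilon>_nonneg lim ineq pair_map_flat pair_0 zeros show ?thesis by blast
qed

end
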